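(* For all integers $n\ge 0$ and $m\ge 1$, $$\tilde{F}_{n+m}=\sum_{i=0}^{m}\sum_{j=i}^{m}\ \sum_{k_1+k_2+\cdots+k_{i+2}=n}\binom{n}{k_1,k_2,\dots,k_{i+2}}(-1)^{i+j}\,j^{\underline{i}}\,{m\brace j}\,j^{k_1}\,\tilde{F}_{k_2}\prod_{s=3}^{i+2}F_{k_s},$$ where the innermost sum is over all tuples $(k_1,\dots,k_{i+2})$ of non-negative integers with sum $n$.
   Context: For $n\ge 0$ let $[n]=\{1,\dots,n\}$. A partition of $[n]$ into $k$ blocks is written $B_1|B_2|\cdots|B_k$, with non-empty disjoint blocks whose union is $[n]$, listed so that $\min B_1<\min B_2<\cdots<\min B_k$. A deranged partition of $[n]$ is an arrangement $B_{\sigma(1)}|B_{\sigma(2)}|\cdots|B_{\sigma(k)}$ of the blocks of some partition $B_1|\cdots|B_k$ of $[n]$, where $\sigma$ is a permutation of $[k]$ such that $B_{\sigma(i)}\neq B_i$ for all $1\le i\le k$ (i.e. $\sigma$ is a derangement). The deranged Bell number $\tilde{F}_n$ is the total number of deranged partitions of $[n]$ (over all $k$), with $\tilde{F}_0=1$. ${n\brace k}$ is the Stirling number of the second kind (the number of partitions of $[n]$ into $k$ non-empty blocks), and $F_n=\sum_{k=0}^n k!\,{n\brace k}$ is the ordered Bell (Fubini) number. The falling factorial is $j^{\underline{i}}=j(j-1)\cdots(j-i+1)$ for $i\ge 1$ and $j^{\underline{0}}=1$. $\binom{n}{k_1,\dots,k_{r}}=\frac{n!}{k_1!\cdots k_r!}$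 is the multinomial coefficient. Empty products equal $1$, and $0^0=1$. *)

theory Defs
  imports
    "HOL-Library.Disjoint_Sets"
    "HOL-Combinatorics.Permutations"
    "HOL-Combinatorics.Stirling"
begin

definition ordered_blocks :: "nat \<Rightarrow> nat set list \<Rightarrow> bool" where
  "ordered_blocks n bs \<longleftrightarrow>
     partition_on {1..n} (set bs) \<and> sorted_wrt (\<lambda>B C. Min B < Min C) bs"

text \<open>
  A deranged partition is the arrangement itself, i.e. the list of blocks in its new order.
  List positions and the permutation are indexed from 0, and
  \<^term>\<open>permute_list \<sigma> bs ! i = bs ! \<sigma> i\<close> for \<^term>\<open>i < length bs\<close>.
\<close>

definition deranged_partitions :: "nat \<Rightarrow> nat set list set" where
  "deranged_partitions n =
     {permute_list \<sigma> bs | \<sigma> bs.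
        ordered_blocks n bs \<and> \<sigma> permutes {..<length bs} \<and>
        (\<forall>i<length bs. bs ! \<sigma> i \<noteq> bs ! i)}"

definition deranged_bell :: "nat \<Rightarrow> nat" where
  "deranged_bell n = card (deranged_partitions n)"

definition ordered_bell :: "nat \<Rightarrow> nat" where
  "ordered_bell n = (\<Sum>k=0..n. fact k * Stirling n k)"

definition falling_factorial :: "'a::comm_ring_1 \<Rightarrow> nat \<Rightarrow> 'a" where
  "falling_factorial x i = (\<Prod>s<i. x - of_nat s)"

text \<open>
  The division is exact whenever \<^term>\<open>sum_list ks = n\<close>; see \<open>prod_fact_dvd_fact_sum_list\<close>.
\<close>

definition multinomial :: "nat \<Rightarrow> nat list \<Rightarrow> nat" where
  "multinomial n ks = fact n div (\<Prod>k\<leftarrow>ks. fact k)"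

lemma prod_fact_dvd_fact_sum_list:
  "(\<Prod>k\<leftarrow>ks. fact k :: nat) dvd fact (sum_list ks)"
proof (induction ks)
  case (Cons k ks)
  have "fact k * (\<Prod>k\<leftarrow>ks. fact k :: nat) dvd fact k * fact (sum_list ks)"
    using Cons.IH by (rule mult_dvd_mono[OF dvd_refl])
  also have "\<dots> dvd fact (k + sum_list ks)"
    by (rule fact_fact_dvd_fact)
  finally show ?case by simp
qed simp

lemma finite_deranged_partitions: "finite (deranged_partitions n)"
proof (rule finite_subset)
  show "deranged_partitions n \<subseteq> {cs. set cs \<subseteq> Pow {1..n} \<and> distinct cs}"
  proof
    fix cs assume "cs \<in> deranged_partitions n"
    then obtain \<sigma> bs where cs: "cs = permute_list \<sigma> bs" and bs: "ordered_blocks n bs"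
      and \<sigma>: "\<sigma> permutes {..<length bs}"
      by (auto simp: deranged_partitions_def)
    have "distinct bs"
      using bs unfolding ordered_blocks_def
      by (auto simp: distinct_conv_nth sorted_wrt_iff_nth_less)
        (metis less_irrefl nat_neq_iff)
    moreover have "set bs \<subseteq> Pow {1..n}"
      using bs by (auto simp: ordered_blocks_def partition_on_def)
    ultimately show "cs \<in> {cs. set cs \<subseteq> Pow {1..n} \<and> distinct cs}"
      using \<sigma> by (simp add: cs)
  qed
  show "finite {cs. set cs \<subseteq> Pow {1..n} \<and> distinct cs}"
    by (rule finite_subset_distinct) simp
qed

lemma deranged_bell_0: "deranged_bell 0 = 1"
proof -
  have "deranged_partitions 0 = {[]}"
    by (force simp: deranged_partitions_def ordered_blocks_def partition_on_empty permutes_id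
          intro: exI[of _ id])
  then show ?thesis by (simp add: deranged_bell_def)
qed

lemma card_partition_on_insert:
  assumes A: "finite A" and a: "a \<notin> A"
  shows "card {P. partition_on (insert a A) P \<and> card P = Suc k} =
           Suc k * card {P. partition_on A P \<and> card P = Suc k} +
           card {P. partition_on A P \<and> card P = k}"
proof -
  let ?S = "\<lambda>k. {P. partition_on A P \<and> card P = k}"
  let ?f = "\<lambda>(Q, X). insert (insert a X) (Q - {X})"
  let ?U = "Sigma (?S (Suc k)) (\<lambda>Q. Q)"
  have finS: "finite (?S j)" for j
    by (rule finite_subset[OF _ finitely_many_partition_on[OF A]]) auto
  have finQ: "finite Q" if "partition_on A Q" for Q
    using finite_elements[OF A that] .
  have aQ: "a \<notin> X" if "partition_on A Q" "X \<in> Q" for Q X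
    using that a by (auto simp: partition_on_def)
  have split: "{P. partition_on (insert a A) P \<and> card P = Suc k} = ?f ` ?U \<union> insert {a} ` ?S k"
    (is "?L = ?R")
  proof (intro equalityI subsetI)
    fix P assume "P \<in> ?L"
    then have P: "partition_on (insert a A) P" and c: "card P = Suc k" by auto
    have finP: "finite P" using c card.infinite by fastforce
    have disjP: "disjnt p q" if "p \<in> P" "q \<in> P" "p \<noteq> q" for p q
      using P that by (auto simp: partition_on_def pairwise_def)
    obtain Y where Y: "Y \<in> P" "a \<in> Y" using P by (auto simp: partition_on_def)
    have other: "a \<notin> Z" if "Z \<in> P" "Z \<noteq> Y" for Z
      using disjP[OF that(1) Y(1) that(2)] Y(2) by (auto simp: disjnt_iff)
    show "P \<in> ?R"
    proof (cases "Y = {a}")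
      case True
      have eq: "P = insert {a} (P - {{a}})" using Y True by auto
      have "disjnt {a} (\<Union>(P - {{a}}))" using other True by auto
      from partition_on_insert[OF this, of "insert a A"]
      have "partition_on A (P - {{a}})" using P eq a by simp
      moreover have "card (P - {{a}}) = k" using c Y True finP by simp
      ultimately show ?thesis using eq by blast
    next
      case False
      let ?X = "Y - {a}" let ?Q = "insert ?X (P - {Y})"
      have X: "?X \<noteq> {}" using False Y by auto
      have XP: "?X \<notin> P"
      proof
        assume "?X \<in> P"
        moreover have "?X \<noteq> Y" using Y by auto
        ultimately have "disjnt ?X Y" using disjP Y(1) by blast
        then show False using X by (auto simp: disjnt_iff)
      qed
      have "partition_on A ?Q"
      proof (rule partition_onI)
        show "\<Union>?Q = A"
        proof -
          have "\<Union>P = insert a A" using P by (simp add: partition_on_def)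
          moreover have "\<Union>P = Y \<union> \<Union>(P - {Y})" using Y by auto
          moreover have "a \<notin> \<Union>(P - {Y})" using other by auto
          ultimately show ?thesis using a Y by auto
        qed
        show "{} \<notin> ?Q" using X P by (auto simp: partition_on_def)
        have X_disj: "disjnt ?X q" if "q \<in> P - {Y}" for q
          using disjP[of Y q] Y(1) that by (auto simp: disjnt_iff)
        fix p q assume "p \<in> ?Q" "q \<in> ?Q" "p \<noteq> q"
        then consider "p = ?X" "q \<in> P - {Y}" | "q = ?X" "p \<in> P - {Y}" | "p \<in> P" "q \<in> P" by blast
        then show "disjnt p q"
          using X_disj disjP \<open>p \<noteq> q\<close> by cases (auto simp: disjnt_sym)
      qed
      moreover have "card ?Q = Suc k" using XP c Y finP by simp
      moreover have "?f (?Q, ?X) = P" using XP Y by (auto simp: insert_absorb)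
      ultimately have "P \<in> ?f ` ?U" by (intro image_eqI[of _ _ "(?Q, ?X)"]) auto
      then show ?thesis by blast
    qed
  next
    fix P assume "P \<in> ?R"
    then consider Q X where "partition_on A Q" "card Q = Suc k" "X \<in> Q" "P = ?f (Q, X)"
      | Q where "partition_on A Q" "card Q = k" "P = insert {a} Q" by auto
    then show "P \<in> ?L"
    proof cases
      case 1
      have "partition_on (insert a A) P"
      proof (rule partition_onI)
        have "\<Union>Q = X \<union> \<Union>(Q - {X})" using 1(3) by auto
        then show "\<Union>P = insert a A" using 1 by (auto simp: partition_on_def)
        show "{} \<notin> P" using 1 by (auto simp: partition_on_def)
        have disjQ: "disjnt p q" if "p \<in> Q" "q \<in> Q" "p \<noteq> q" for p q
          using 1(1) that by (auto simp: partition_on_def pairwise_def)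
        have X_disj: "disjnt (insert a X) q" if "q \<in> Q - {X}" for q
          using disjQ[of X q] 1(3) that aQ[OF 1(1), of q] by auto
        fix p q assume "p \<in> P" "q \<in> P" "p \<noteq> q"
        then consider "p = insert a X" "q \<in> Q - {X}" | "q = insert a X" "p \<in> Q - {X}"
          | "p \<in> Q" "q \<in> Q" using 1(4) by auto
        then show "disjnt p q"
          using X_disj disjQ \<open>p \<noteq> q\<close> by cases (auto simp: disjnt_sym)
      qed
      moreover have "insert a X \<notin> Q" using aQ[OF 1(1)] by blast
      then have "card P = Suc k" using 1 finQ[OF 1(1)] by simp
      ultimately show ?thesis by simp
    next
      case 2
      have "partition_on (insert a A) P"
        using 2 aQ[OF 2(1)] by (auto simp: partition_on_def pairwise_insert disjnt_iff)
      moreover have "{a} \<notin> Q" using aQ[OF 2(1)] by blast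
      then have "card P = Suc k" using 2 finQ[OF 2(1)] by simp
      ultimately show ?thesis by simp
    qed
  qed
  have inj1: "inj_on ?f ?U"
  proof (rule inj_onI, clarify)
    fix Q X Q' X'
    assume Q: "partition_on A Q" and X: "X \<in> Q" and Q': "partition_on A Q'" and X': "X' \<in> Q'"
      and eq: "insert (insert a X) (Q - {X}) = insert (insert a X') (Q' - {X'})"
    have nQ: "insert a Z \<notin> Q" "insert a Z \<notin> Q'" for Z
      using aQ[OF Q] aQ[OF Q'] by blast+
    have "insert a X \<in> insert (insert a X') (Q' - {X'})" using eq by blast
    then have "insert a X = insert a X'" using nQ by blast
    then have "X = X'" using aQ[OF Q X] aQ[OF Q' X'] by (simp add: insert_ident)
    moreover have "Q - {X} = Q' - {X'}"
    proof -
      have "insert a X \<notin> Q - {X}" "insert a X \<notin> Q' - {X'}" using nQ by auto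
      then show ?thesis using eq \<open>X = X'\<close> by (simp add: insert_ident)
    qed
    ultimately show "Q = Q' \<and> X = X'" using X X' by (metis insert_Diff)
  qed
  have inj2: "inj_on (insert {a}) (?S k)"
  proof (rule inj_onI)
    fix Q Q' assume "Q \<in> ?S k" "Q' \<in> ?S k" and eq: "insert {a} Q = insert {a} Q'"
    then have "{a} \<notin> Q" "{a} \<notin> Q'" using aQ[of Q "{a}"] aQ[of Q' "{a}"] by auto
    with eq show "Q = Q'" by (simp add: insert_ident)
  qed
  have disj: "?f ` ?U \<inter> insert {a} ` ?S k = {}"
  proof -
    have no: False if Q: "partition_on A Q" "X \<in> Q" and eq: "?f (Q, X) = insert {a} Q'" for Q X Q'
    proof -
      have "{a} \<in> insert (insert a X) (Q - {X})" using eq by auto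
      moreover have "{a} \<notin> Q" using aQ[OF Q(1), of "{a}"] by auto
      ultimately have "insert a X = {a}" by blast
      then have "X = {}" using aQ[OF Q] by auto
      then show False using Q by (auto simp: partition_on_def)
    qed
    have ne: "?f p \<noteq> insert {a} Q'" if "p \<in> ?U" for p Q'
      using that no by (cases p) auto
    show ?thesis
    proof (rule equals0I)
      fix P assume "P \<in> ?f ` ?U \<inter> insert {a} ` ?S k"
      then obtain p Q' where "p \<in> ?U" "P = ?f p" "P = insert {a} Q'" by (elim IntE imageE)
      then show False using ne[of p Q'] by simp
    qed
  qed
  have finU: "finite ?U" using finS finQ by (intro finite_SigmaI) auto
  have cardU: "card ?U = Suc k * card (?S (Suc k))"
    using finS finQ by (subst card_SigmaI) auto
  show ?thesis
    unfolding split using finU finS disj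
    by (subst card_Un_disjoint) (simp_all add: card_image[OF inj1] card_image[OF inj2] cardU)
qed

text \<open>
  The library's recursively defined \<^const>\<open>Stirling\<close> counts partitions into $k$ blocks.
\<close>

lemma card_partition_on_eq_Stirling:
  assumes "finite A"
  shows "card {P. partition_on A P \<and> card P = k} = Stirling (card A) k"
  using assms
proof (induction A arbitrary: k rule: finite_induct)
  case empty
  show ?case
    by (cases k) (auto simp: partition_on_empty conj_commute cong: conj_cong)
next
  case (insert a A)
  show ?case
  proof (cases k)
    case 0
    have "card P \<noteq> 0" if "partition_on (insert a A) P" for P
      using that finite_elements[OF _ that] insert.hyps(1) by (auto simp: partition_on_def)
    then have "{P. partition_on (insert a A) P \<and> card P = k} = {}" using 0 by auto
    then show ?thesis using 0 insert.hyps by (simp only: card.empty) simp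
  next
    case (Suc k')
    show ?thesis
      unfolding Suc card_partition_on_insert[OF insert.hyps] insert.IH
      using insert.hyps by simp
  qed
qed

end

theory Submission
  imports Defs "HOL-Computational_Algebra.Formal_Power_Series"
begin

text \<open>
  The identity is the comparison of coefficients in the $m$-th derivative of the exponential
  generating function of the deranged Bell numbers.

  Let $d_k$ be the number of derangements of $k$ objects. A deranged partition is a set partition,
  listed in its canonical order, together with a derangement of its blocks, so
  $\tilde F_n = \sum_k d_k {n\brace k}$; likewise $F_n = \sum_k k!\,{n\brace k}$ by definition.
  Since ${n\brace k}\,k!/n!$ is the coefficient of $x^n$ in $(e^x-1)^k$, passing from $(a_k)$ to
  $\sum_k a_k {n\brace k}$ substitutes $y = e^x - 1$ into the exponential generating function.
  With $h(y) = 1/(1-y)$ and the classical $g(y) = e^{-y}/(1-y) = \sum_k d_k y^k/k!$, the series of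
  $\tilde F$ and $F$ are therefore $g(e^x-1)$ and $h(e^x-1)$ (\<open>egf_deranged_bell\<close> and
  \<open>egf_ordered_bell\<close>).

  Two derivative formulas now produce the right-hand side. Because $y' = e^x$, the $m$-th
  derivative of $f(e^x-1)$ is $\sum_j {m\brace j}\,e^{jx} f^{(j)}(e^x-1)$
  (\<open>fps_nth_deriv_compose_exp_minus_1\<close>). Because $h' = h^2$ and $g' = g h - g$, the $j$-th derivative
  of $g$ is $\sum_i (-1)^{i+j} j^{\underline{i}}\,g h^i$ (\<open>fps_nth_deriv_derangement\<close>). Hence
  the $m$-th derivative of the series of $\tilde F$ is a combination of the products of $e^{jx}$,
  one copy of the series of $\tilde F$ and $i$ copies of the series of $F$. The $n$-th coefficient of
  such a product of $i+2$ exponential generating functions is a multinomial convolution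
  (\<open>egf_prod_nth\<close>), whose first factor contributes $j^{k_1}$, while the $m$-th derivative shifts
  the sequence $\tilde F$ by $m$.
\<close>

unbundle fps_syntax

section \<open>Counting derangements\<close>

definition derangements :: "'a set \<Rightarrow> ('a \<Rightarrow> 'a) set" where
  "derangements A = {p. p permutes A \<and> (\<forall>x\<in>A. p x \<noteq> x)}"

lemma finite_derangements: "finite A \<Longrightarrow> finite (derangements A)"
  by (rule finite_subset[OF _ finite_permutations[of A]]) (auto simp: derangements_def)

text \<open>
  Every permutation is a derangement of the set of points that it moves.
\<close>

lemma permutations_eq_UN_derangements: "{p. p permutes A} = (\<Union>B\<in>Pow A. derangements B)"
proof (intro equalityI subsetI)
  fix p assume "p \<in> {p. p permutes A}"
  then have p: "p permutes A" by simp
  have "p permutes {x. p x \<noteq> x}"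
    using p by (auto simp: permutes_def) 
  moreover have "{x. p x \<noteq> x} \<subseteq> A"
    using p by (auto simp: permutes_def)
  ultimately show "p \<in> (\<Union>B\<in>Pow A. derangements B)"
    by (auto simp: derangements_def)
next
  fix p assume "p \<in> (\<Union>B\<in>Pow A. derangements B)"
  then show "p \<in> {p. p permutes A}"
    by (auto simp: derangements_def intro: permutes_subset)
qed

lemma derangements_moved: "p \<in> derangements A \<Longrightarrow> {x. p x \<noteq> x} = A"
  by (auto simp: derangements_def permutes_def)

lemma fact_eq_sum_card_derangements:
  assumes "finite A"
  shows "fact (card A) = (\<Sum>B\<in>Pow A. card (derangements B))"
proof -
  have "fact (card A) = card {p. p permutes A}"
    using assms by (simp add: card_permutations)
  also have "\<dots> = (\<Sum>B\<in>Pow A. card (derangements B))"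
    unfolding permutations_eq_UN_derangements
  proof (rule card_UN_disjoint)
    show "\<forall>B\<in>Pow A. \<forall>C\<in>Pow A. B \<noteq> C \<longrightarrow> derangements B \<inter> derangements C = {}"
      using derangements_moved by blast
  qed (use assms in \<open>auto intro: finite_derangements finite_subset\<close>)
  finally show ?thesis .
qed

text \<open>
  There are $\binom{n}{k}$ subsets of each size $k$, which turns a sum over subsets into a binomial
  sum.
\<close>

lemma sum_Pow_card:
  fixes f :: "nat \<Rightarrow> 'b::comm_semiring_1"
  assumes "finite A"
  shows "(\<Sum>B\<in>Pow A. f (card B)) = (\<Sum>k\<le>card A. of_nat (card A choose k) * f k)"
proof -
  have "(\<Sum>B\<in>Pow A. f (card B)) = (\<Sum>k\<le>card A. \<Sum>B | B \<in> Pow A \<and> card B = k. f (card B))"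
    using assms by (intro sum.group[symmetric]) (auto intro: card_mono)
  also have "\<dots> = (\<Sum>k\<le>card A. of_nat (card A choose k) * f k)"
    using assms by (intro sum.cong refl) (simp add: n_subsets)
  finally show ?thesis .
qed

definition geom_fps :: "real fps" where
  "geom_fps = Abs_fps (\<lambda>_. 1)"

definition derangement_fps :: "real fps" where
  "derangement_fps = fps_exp (- 1) * geom_fps"

text \<open>
  Moebius inversion over the subsets of $A$ of the count $n! = \sum_{B\subseteq A} d_{|B|}$ gives
  $d_n = \sum_k \binom{n}{k} (-1)^{n-k} k!$, that is,
  $d_n/n! = \sum_k (-1)^{n-k}/(n-k)!$, which are the coefficients of $e^{-y}/(1-y)$.
  So the number of derangements depends on $A$ only through its size.
\<close>

lemma card_derangements:
  assumes "finite A"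
  shows "real (card (derangements A)) = fact (card A) * derangement_fps $ card A"
proof -
  let ?n = "card A"
  have fact_eq: "(fact (card B) :: real) = (\<Sum>C\<in>Pow B. real (card (derangements C)))"
    if "finite B" for B :: "'a set"
    using arg_cong[OF fact_eq_sum_card_derangements[OF that], of real] by simp
  have "real (card (derangements A)) = (\<Sum>B\<in>Pow A. (- 1) ^ (?n - card B) * fact (card B))"
    using fact_eq assms by (rule inclusion_exclusion_mobius)
  also have "\<dots> = (\<Sum>k\<le>?n. real (?n choose k) * ((- 1) ^ (?n - k) * fact k))"
    using assms by (rule sum_Pow_card)
  also have "\<dots> = (\<Sum>k\<le>?n. fact ?n * ((- 1) ^ (?n - k) / fact (?n - k)))"
    by (intro sum.cong refl) (simp add: binomial_fact field_simps)
  also have "\<dots> = (\<Sum>k\<le>?n. fact ?n * ((- 1) ^ k / fact k))"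
    by (rule sum.reindex_bij_witness[of _ "\<lambda>k. ?n - k" "\<lambda>k. ?n - k"]) auto
  also have "\<dots> = fact ?n * derangement_fps $ ?n"
    by (simp add: derangement_fps_def geom_fps_def fps_mult_nth atLeast0AtMost sum_distrib_left)
  finally show ?thesis .
qed

section \<open>Stirling numbers and substitution of $e^x - 1$\<close>

text \<open>
  The derivative of $(e^x-1)^k$ is $k\,e^x (e^x-1)^{k-1} = k\,((e^x-1)^k + (e^x-1)^{k-1})$, and on
  coefficients this is the recurrence
  ${n+1\brace k} = k\,{n\brace k} + {n\brace k-1}$.
\<close>

lemma fps_exp_minus_1_power_nth:
  "(fps_exp 1 - 1 :: real fps) ^ k $ n = fact k * real (Stirling n k) / fact n"
proof (induction n arbitrary: k)
  case 0
  show ?case by (cases k) (simp_all add: fps_power_zeroth)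
next
  case (Suc n)
  let ?e = "fps_exp 1 - 1 :: real fps"
  show ?case
  proof (cases k)
    case 0
    then show ?thesis by simp
  next
    case [simp]: (Suc l)
    have "fps_deriv (?e ^ k) = of_nat k * fps_exp 1 * ?e ^ l"
      unfolding fps_deriv_power' by simp
    also have "\<dots> = of_nat k * (?e ^ k + ?e ^ l)"
      by (simp add: left_diff_distrib mult.assoc)
    finally have "fps_deriv (?e ^ k) $ n = (of_nat k * (?e ^ k + ?e ^ l)) $ n"
      by (rule arg_cong)
    then have "real (Suc n) * ?e ^ k $ Suc n = real k * (?e ^ k $ n + ?e ^ l $ n)"
      by (simp del: power_Suc of_nat_Suc fps_deriv_power add: fps_mult_of_nat_nth)
    also have "\<dots> = fact k * real (Stirling (Suc n) k) / fact n"
      unfolding Suc.IH by (simp add: field_simps)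
    finally have "?e ^ k $ Suc n = fact k * real (Stirling (Suc n) k) / fact n / real (Suc n)"
      by (simp only: nonzero_eq_divide_eq[OF of_nat_neq_0] mult.commute)
    then show ?thesis by (simp only: fact_Suc divide_divide_eq_left mult.commute)
  qed
qed

lemma fps_compose_exp_minus_1_nth:
  "(f oo (fps_exp 1 - 1)) $ n = (\<Sum>k\<le>n. fact k * f $ k * real (Stirling n k)) / fact n"
  by (simp add: fps_compose_nth fps_exp_minus_1_power_nth sum_divide_distrib atLeast0AtMost
      mult_ac)

section \<open>Exponential generating functions\<close>

definition egf :: "(nat \<Rightarrow> nat) \<Rightarrow> real fps" where
  "egf a = Abs_fps (\<lambda>n. real (a n) / fact n)"

lemma egf_nth: "egf a $ n = real (a n) / fact n"
  by (simp add: egf_def)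

lemma egf_power: "egf (\<lambda>k. j ^ k) = fps_exp (real j)"
  by (rule fps_ext) (simp add: egf_nth)

lemma fps_nth_deriv_egf: "fps_nth_deriv m (egf a) = egf (\<lambda>n. a (n + m))"
proof (induction m arbitrary: a)
  case (Suc m)
  have "fps_deriv (egf a) = egf (\<lambda>n. a (Suc n))"
    by (rule fps_ext) (simp add: egf_nth del: of_nat_Suc)
  then show ?case using Suc by simp
qed simp

text \<open>
  A coefficient of a product of series is a sum over the tuples with sum $n$
  (\<open>fps_prod_nth\<close>); the factorials in the denominators combine with $n!$ to the multinomial
  coefficient.
\<close>

lemma egf_prod_nth:
  "fact n * (\<Prod>s=0..r. egf (a s)) $ n =
    (\<Sum>ks | length ks = Suc r \<and> sum_list ks = n.
       real (multinomial n ks) * (\<Prod>s=0..r. real (a s (ks ! s))))"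
proof -
  have "fact n * (\<Prod>s=0..r. real (a s (ks ! s)) / fact (ks ! s)) =
      real (multinomial n ks) * (\<Prod>s=0..r. real (a s (ks ! s)))"
    if "length ks = Suc r" "sum_list ks = n" for ks
  proof -
    have "(\<Prod>k\<leftarrow>ks. fact k :: nat) = (\<Prod>s=0..r. fact (ks ! s))"
      using that(1) by (simp add: prod.list_conv_set_nth atLeastLessThanSuc_atLeastAtMost)
    then have "real (multinomial n ks) = fact n / (\<Prod>s=0..r. fact (ks ! s))"
      using prod_fact_dvd_fact_sum_list[of ks] that(2)
      by (simp add: multinomial_def real_of_nat_div)
    then show ?thesis by (simp add: prod_dividef)
  qed
  then show ?thesis
    by (simp add: fps_prod_nth natpermute_def egf_nth sum_distrib_left)
qed

section \<open>Deranged partitions as derangements of blocks\<close>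

lemma ordered_blocks_distinct: "ordered_blocks n bs \<Longrightarrow> distinct bs"
  unfolding ordered_blocks_def
  by (auto simp: distinct_conv_nth sorted_wrt_iff_nth_less) (metis less_irrefl nat_neq_iff)

text \<open>
  The blocks of a partition are disjoint and non-empty, so their minima are distinct and the listing
  by increasing minimum is unique. The inverse sorts the minima and maps each one back to its block.
\<close>

lemma bij_betw_ordered_blocks:
  "bij_betw set {bs. ordered_blocks n bs} {P. partition_on {1..n} P}"
proof -
  let ?list = "\<lambda>P. map (inv_into P Min) (sorted_list_of_set (Min ` P))"
  have fin: "finite P" if "partition_on {1..n} P" for P
    using finite_elements[OF _ that] by simp
  have inj: "inj_on Min P" if P: "partition_on {1..n} P" for P
  proof (rule inj_onI)
    fix B C assume BC: "B \<in> P" "C \<in> P" "Min B = Min C"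
    have "Min X \<in> X" if "X \<in> P" for X
      using P that by (intro Min_in) (auto simp: partition_on_def intro: finite_subset)
    then have "\<not> disjnt B C"
      using BC by (metis disjnt_iff)
    then show "B = C"
      using P BC by (auto simp: partition_on_def pairwise_def)
  qed
  show ?thesis
  proof (rule bij_betw_byWitness[where f' = ?list])
    show "\<forall>bs\<in>{bs. ordered_blocks n bs}. ?list (set bs) = bs"
    proof clarify
      fix bs assume bs: "ordered_blocks n bs"
      then have P: "partition_on {1..n} (set bs)" and "sorted_wrt (<) (map Min bs)"
        by (auto simp: ordered_blocks_def sorted_wrt_map)
      then have "sorted_list_of_set (Min ` set bs) = map Min bs"
        by (intro strict_sorted_equal) auto
      then show "?list (set bs) = bs"
        using inj[OF P] by (simp add: map_idI)
    qed
    show "\<forall>P\<in>{P. partition_on {1..n} P}. set (?list P) = P"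
      using fin inj by (auto simp: image_image)
    show "set ` {bs. ordered_blocks n bs} \<subseteq> {P. partition_on {1..n} P}"
      by (auto simp: ordered_blocks_def)
    show "?list ` {P. partition_on {1..n} P} \<subseteq> {bs. ordered_blocks n bs}"
    proof clarify
      fix P assume P: "partition_on {1..n} P"
      have set: "set (?list P) = P"
        using fin[OF P] inj[OF P] by (auto simp: image_image)
      have "map Min (?list P) = sorted_list_of_set (Min ` P)"
        using fin[OF P] by (auto simp: f_inv_into_f intro: map_idI)
      then have "sorted_wrt (<) (map Min (?list P))"
        using strict_sorted_list_of_set by metis
      then show "ordered_blocks n (?list P)"
        using P set by (simp only: ordered_blocks_def sorted_wrt_map)
    qed
  qed
qed

text \<open>
  The blocks are pairwise distinct, so requiring that no position keeps its block says that the
  permutation of positions has no fixed point.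
\<close>

lemma deranged_partitions_eq_image:
  "deranged_partitions n =
    (\<lambda>(bs, \<sigma>). permute_list \<sigma> bs) `
      (SIGMA bs:{bs. ordered_blocks n bs}. derangements {..<length bs})"
proof -
  have "(\<forall>i<length bs. bs ! \<sigma> i \<noteq> bs ! i) \<longleftrightarrow> (\<forall>i\<in>{..<length bs}. \<sigma> i \<noteq> i)"
    if "ordered_blocks n bs" "\<sigma> permutes {..<length bs}" for bs \<sigma>
    using that ordered_blocks_distinct[OF that(1)] permutes_in_image[OF that(2)]
    by (auto simp: nth_eq_iff_index_eq)
  then show ?thesis
    unfolding deranged_partitions_def derangements_def by (auto simp: image_iff) blast+
qed

text \<open>
  The arrangement determines both data: its underlying set is the partition, hence fixes the
  canonical listing, and distinctness of the blocks then recovers the permutation.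
\<close>

lemma inj_on_permute_ordered_blocks:
  "inj_on (\<lambda>(bs, \<sigma>). permute_list \<sigma> bs)
      (SIGMA bs:{bs. ordered_blocks n bs}. derangements {..<length bs})"
proof (rule inj_onI, clarify)
  fix bs \<sigma> cs \<tau>
  assume bs: "ordered_blocks n bs" and cs: "ordered_blocks n cs"
    and "\<sigma> \<in> derangements {..<length bs}" "\<tau> \<in> derangements {..<length cs}"
    and eq: "permute_list \<sigma> bs = permute_list \<tau> cs"
  then have \<sigma>: "\<sigma> permutes {..<length bs}" and \<tau>: "\<tau> permutes {..<length cs}"
    by (auto simp: derangements_def)
  have "set bs = set cs"
    using arg_cong[OF eq, of set] \<sigma> \<tau> by simp
  then have [simp]: "cs = bs"
    using bij_betw_imp_inj_on[OF bij_betw_ordered_blocks] bs cs by (auto dest: inj_onD)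
  have "\<sigma> i = \<tau> i" for i
  proof (cases "i < length bs")
    case True
    then have "bs ! \<sigma> i = bs ! \<tau> i"
      using arg_cong[OF eq, of "\<lambda>xs. xs ! i"] \<sigma> \<tau> by (simp add: permute_list_nth)
    then show ?thesis
      using True ordered_blocks_distinct[OF bs] permutes_in_image[OF \<sigma>, of i]
        permutes_in_image[OF \<tau>, of i]
      by (simp add: nth_eq_iff_index_eq)
  next
    case False
    then show ?thesis using \<sigma> \<tau> by (simp add: permutes_def)
  qed
  then show "bs = cs \<and> \<sigma> = \<tau>" by auto
qed

lemma deranged_bell_eq_sum_Stirling:
  "deranged_bell n = (\<Sum>k\<le>n. card (derangements {..<k}) * Stirling n k)"
proof -
  let ?D = "\<lambda>k. card (derangements {..<k})"
  let ?\<P> = "{P. partition_on {1..n} P}"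
  have fin: "finite ?\<P>" 
    using finitely_many_partition_on[of "{1..n}"] by simp
  have finB: "finite {bs. ordered_blocks n bs}"
    using bij_betw_finite[OF bij_betw_ordered_blocks] fin by blast
  have le: "card P \<le> n" if "P \<in> ?\<P>" for P
  proof (rule ccontr)
    \<comment> \<open>A partition with more than $n$ blocks would be counted by a vanishing Stirling number.\<close>
    assume "\<not> card P \<le> n"
    then have "card {Q. partition_on {1..n} Q \<and> card Q = card P} = 0"
      by (simp add: card_partition_on_eq_Stirling)
    then show False
      using that fin by (auto simp: card_eq_0_iff)
  qed
  have "deranged_bell n = (\<Sum>bs | ordered_blocks n bs. ?D (length bs))"
    unfolding deranged_bell_def deranged_partitions_eq_image
      card_image[OF inj_on_permute_ordered_blocks]
    using finB by (subst card_SigmaI) (auto intro: finite_derangements)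
  also have "\<dots> = (\<Sum>bs | ordered_blocks n bs. ?D (card (set bs)))"
    by (intro sum.cong refl) (auto dest!: ordered_blocks_distinct simp: distinct_card)
  also have "\<dots> = (\<Sum>P\<in>?\<P>. ?D (card P))"
    using bij_betw_ordered_blocks by (rule sum.reindex_bij_betw)
  also have "\<dots> = (\<Sum>k\<le>n. \<Sum>P | P \<in> ?\<P> \<and> card P = k. ?D (card P))"
    using fin le by (intro sum.group[symmetric]) auto
  also have "\<dots> = (\<Sum>k\<le>n. ?D k * Stirling n k)"
    by (intro sum.cong refl) (simp add: card_partition_on_eq_Stirling)
  finally show ?thesis .
qed

lemma egf_deranged_bell: "egf deranged_bell = derangement_fps oo (fps_exp 1 - 1)"
  by (rule fps_ext)
    (simp add: egf_nth fps_compose_exp_minus_1_nth deranged_bell_eq_sum_Stirling card_derangements)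

lemma egf_ordered_bell: "egf ordered_bell = geom_fps oo (fps_exp 1 - 1)"
  by (rule fps_ext)
    (simp add: egf_nth fps_compose_exp_minus_1_nth ordered_bell_def geom_fps_def atLeast0AtMost)

section \<open>Iterated derivatives\<close>

lemma falling_factorial_Suc:
  "falling_factorial x (Suc i) = falling_factorial x i * (x - of_nat i)"
  by (simp add: falling_factorial_def)

text \<open>
  The difference rule for falling factorials; it is the recurrence in $j$ of the coefficients of
  the $j$-th derivative of $g$.
\<close>

lemma falling_factorial_plus_1:
  "falling_factorial (x + 1) (Suc i) =
    falling_factorial x (Suc i) + of_nat (Suc i) * falling_factorial x i"
proof -
  have "falling_factorial (x + 1) (Suc i) = (x + 1) * falling_factorial x i"
    unfolding falling_factorial_def by (subst prod.lessThan_Suc_shift) simp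
  then show ?thesis by (simp add: falling_factorial_Suc algebra_simps)
qed

lemma falling_factorial_of_nat_eq_0: "j < i \<Longrightarrow> falling_factorial (of_nat j) i = 0"
  unfolding falling_factorial_def by (rule prod_zero) auto

lemma fps_deriv_geom: "fps_deriv geom_fps = geom_fps ^ 2"
  by (rule fps_ext) (simp add: geom_fps_def power2_eq_square fps_mult_nth)

lemma fps_deriv_geom_power: "fps_deriv (geom_fps ^ i) = of_nat i * geom_fps ^ Suc i"
  by (induction i) (simp_all add: fps_deriv_geom power2_eq_square algebra_simps)

lemma fps_deriv_derangement_geom_power:
  "fps_deriv (derangement_fps * geom_fps ^ i) =
    of_nat (Suc i) * (derangement_fps * geom_fps ^ Suc i) - derangement_fps * geom_fps ^ i"
proof -
  have "fps_deriv derangement_fps = derangement_fps * geom_fps - derangement_fps"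
    by (simp add: derangement_fps_def fps_deriv_geom power2_eq_square algebra_simps flip: fps_const_neg)
  then show ?thesis
    by (simp only: fps_deriv_mult fps_deriv_geom_power) (simp add: algebra_simps)
qed

text \<open>
  By the preceding lemma each derivative sends $g h^i$ to $(i+1)\,g h^{i+1} - g h^i$. The
  coefficients $c_{j,i} = (-1)^{i+j} j^{\underline{i}}$ obey the resulting recurrence
  $c_{j+1,i+1} = (i+1)\,c_{j,i} - c_{j,i+1}$, which is the difference rule up to sign.
\<close>

lemma fps_nth_deriv_derangement:
  "fps_nth_deriv j derangement_fps =
    (\<Sum>i\<le>j. fps_const ((- 1) ^ (i + j) * falling_factorial (real j) i) *
       (derangement_fps * geom_fps ^ i))"
proof (induction j)
  case 0
  show ?case by (simp add: falling_factorial_def)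
next
  case (Suc j)
  define c where "c j i = (- 1) ^ (i + j) * falling_factorial (real j) i" for j i
  define T where "T i = derangement_fps * geom_fps ^ i" for i
  have c0: "c (Suc j) 0 = - c j 0"
    by (simp add: c_def falling_factorial_def)
  have cS: "c (Suc j) (Suc i) = real (Suc i) * c j i - c j (Suc i)" for i
    using falling_factorial_plus_1[of "real j" i] by (simp add: c_def algebra_simps)
  have cz: "c j (Suc j) = 0"
    by (simp add: c_def falling_factorial_of_nat_eq_0)
  have dT: "fps_deriv (T i) = of_nat (Suc i) * T (Suc i) - T i" for i
    unfolding T_def by (rule fps_deriv_derangement_geom_power)
  have "fps_nth_deriv (Suc j) derangement_fps = fps_deriv (fps_nth_deriv j derangement_fps)"
    by (rule fps_nth_deriv_commute)
  also have "\<dots> = (\<Sum>i\<le>j. fps_const (real (Suc i) * c j i) * T (Suc i)) -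
      (\<Sum>i\<le>j. fps_const (c j i) * T i)"
    unfolding Suc.IH c_def[symmetric] T_def[symmetric] fps_deriv_sum fps_deriv_mult_const_left dT
    by (simp add: right_diff_distrib sum_subtractf mult_ac
        flip: fps_const_mult fps_of_nat del: of_nat_Suc)
  \<comment> \<open>Appending the zero coefficient $c_{j,j+1}$ lets both sums be indexed by $i+1$.\<close>
  also have "(\<Sum>i\<le>j. fps_const (c j i) * T i) = (\<Sum>i\<le>Suc j. fps_const (c j i) * T i)"
    using cz by simp
  also have "\<dots> = fps_const (c j 0) * T 0 + (\<Sum>i\<le>j. fps_const (c j (Suc i)) * T (Suc i))"
    by (rule sum.atMost_Suc_shift)
  also have "(\<Sum>i\<le>j. fps_const (real (Suc i) * c j i) * T (Suc i)) -
      (fps_const (c j 0) * T 0 + (\<Sum>i\<le>j. fps_const (c j (Suc i)) * T (Suc i))) =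
      fps_const (c (Suc j) 0) * T 0 + (\<Sum>i\<le>j. fps_const (c (Suc j) (Suc i)) * T (Suc i))"
    unfolding c0 cS by (simp add: left_diff_distrib sum_subtractf flip: fps_const_sub fps_const_neg)
  also have "\<dots> = (\<Sum>i\<le>Suc j. fps_const (c (Suc j) i) * T i)"
    by (rule sum.atMost_Suc_shift[symmetric])
  finally show ?case by (simp only: c_def T_def)
qed

text \<open>
  By the chain rule, differentiating $e^{jx} f^{(j)}(e^x-1)$ gives $j$ times itself plus
  $e^{(j+1)x} f^{(j+1)}(e^x-1)$; collecting terms reproduces the recurrence of the Stirling numbers.
\<close>

lemma fps_nth_deriv_compose_exp_minus_1:
  fixes f :: "real fps"
  shows "fps_nth_deriv m (f oo (fps_exp 1 - 1)) =
    (\<Sum>j\<le>m. of_nat (Stirling m j) * (fps_exp (real j) * (fps_nth_deriv j f oo (fps_exp 1 - 1))))"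
proof (induction m)
  case 0
  show ?case by simp
next
  case (Suc m)
  define T where "T j = fps_exp (real j) * (fps_nth_deriv j f oo (fps_exp 1 - 1))" for j
  have dT: "fps_deriv (T j) = of_nat j * T j + T (Suc j)" for j
    by (simp add: T_def fps_compose_deriv fps_nth_deriv_commute fps_exp_add_mult fps_of_nat algebra_simps
         del: fps_nth_deriv.simps)
  have "fps_nth_deriv (Suc m) (f oo (fps_exp 1 - 1)) =
      fps_deriv (fps_nth_deriv m (f oo (fps_exp 1 - 1)))"
    by (rule fps_nth_deriv_commute)
  also have "\<dots> = (\<Sum>j\<le>m. of_nat (Stirling m j * j) * T j) +
      (\<Sum>j\<le>m. of_nat (Stirling m j) * T (Suc j))"
    unfolding Suc.IH T_def[symmetric] fps_deriv_sum by (simp add: dT distrib_left sum.distrib mult_ac)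
  also have "(\<Sum>j\<le>m. of_nat (Stirling m j * j) * T j) = (\<Sum>j\<le>Suc m. of_nat (Stirling m j * j) * T j)"
    by simp
  also have "\<dots> = (\<Sum>j\<le>m. of_nat (Stirling m (Suc j) * Suc j) * T (Suc j))"
    by (subst sum.atMost_Suc_shift) simp
  also have "\<dots> + (\<Sum>j\<le>m. of_nat (Stirling m j) * T (Suc j)) =
      (\<Sum>j\<le>m. of_nat (Stirling (Suc m) (Suc j)) * T (Suc j))"
    by (simp add: algebra_simps sum.distrib del: of_nat_Suc)
  also have "\<dots> = (\<Sum>j\<le>Suc m. of_nat (Stirling (Suc m) j) * T j)"
    by (subst sum.atMost_Suc_shift) simp
  finally show ?case by (simp only: T_def)
qed

section \<open>The convolution formula\<close>

text \<open>
  Substituting $y = e^x - 1$ in the formula for $g^{(j)}$ turns each $g h^i$ into the product of the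
  series of $\tilde F$ with $i$ copies of that of $F$.
\<close>

lemma fps_nth_deriv_egf_deranged_bell:
  "fps_nth_deriv m (egf deranged_bell) =
    (\<Sum>j\<le>m. \<Sum>i\<le>j.
       fps_const ((- 1) ^ (i + j) * falling_factorial (real j) i * real (Stirling m j)) *
       (fps_exp (real j) * egf deranged_bell * egf ordered_bell ^ i))"
proof -
  have "fps_nth_deriv j derangement_fps oo (fps_exp 1 - 1) =
      (\<Sum>i\<le>j. fps_const ((- 1) ^ (i + j) * falling_factorial (real j) i) *
         (egf deranged_bell * egf ordered_bell ^ i))" for j
    by (simp add: fps_nth_deriv_derangement fps_compose_sum_distrib fps_compose_mult_distrib
        fps_compose_power egf_deranged_bell egf_ordered_bell)
  moreover have "fps_nth_deriv m (egf deranged_bell) =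
      (\<Sum>j\<le>m. of_nat (Stirling m j) *
         (fps_exp (real j) * (fps_nth_deriv j derangement_fps oo (fps_exp 1 - 1))))"
    by (simp only: egf_deranged_bell fps_nth_deriv_compose_exp_minus_1)
  ultimately show ?thesis
    by (simp add: sum_distrib_left mult_ac flip: fps_const_mult fps_of_nat)
qed

theorem corollary4p4:
  fixes n m :: nat
  assumes "m \<ge> 1"
  shows "int (deranged_bell (n + m)) =
    (\<Sum>i=0..m. \<Sum>j=i..m. \<Sum>ks | length ks = i + 2 \<and> sum_list ks = n.
       int (multinomial n ks) * (-1) ^ (i + j) * falling_factorial (int j) i *
       int (Stirling m j) * int j ^ (ks ! 0) * int (deranged_bell (ks ! 1)) *
       (\<Prod>s=2..<i+2. int (ordered_bell (ks ! s))))"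
proof -
  define c where "c i j = (- 1) ^ (i + j) * falling_factorial (int j) i * int (Stirling m j)" for i j
  define V where "V i j ks = multinomial n ks * (j ^ (ks ! 0) * deranged_bell (ks ! 1) *
      (\<Prod>s=2..<i+2. ordered_bell (ks ! s)))" for i j ks
  have coeff: "fact n * (fps_exp (real j) * egf deranged_bell * egf ordered_bell ^ i) $ n =
      (\<Sum>ks | length ks = i + 2 \<and> sum_list ks = n. real (V i j ks))" for i j
  proof -
    \<comment> \<open>The factors in the order of the tuple: $e^{jx}$, then the series of $\tilde F$, then $i$ copies
      of that of $F$.\<close>
    define a where "a s = (if s = 0 then (\<lambda>k. j ^ k) else if s = 1 then deranged_bell else ordered_bell)"
      for s :: nat
    have split: "{0..Suc i} = insert 0 (insert 1 {2..<i+2})" by auto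
    have "(\<Prod>s=2..<i+2. egf (a s)) = (\<Prod>s=2..<i+2. egf ordered_bell)"
      by (intro prod.cong) (auto simp: a_def)
    then have "(\<Prod>s=0..Suc i. egf (a s)) = fps_exp (real j) * egf deranged_bell * egf ordered_bell ^ i"
      by (simp add: split a_def egf_power mult_ac)
    moreover have "(\<Prod>s=2..<i+2. real (a s (ks ! s))) = (\<Prod>s=2..<i+2. real (ordered_bell (ks ! s)))" for ks
      by (intro prod.cong) (auto simp: a_def)
    then have "(\<Prod>s=0..Suc i. real (a s (ks ! s))) = real (j ^ (ks ! 0) * deranged_bell (ks ! 1) *
      (\<Prod>s=2..<i+2. ordered_bell (ks ! s)))" for ks
      by (simp add: split a_def)
    ultimately show ?thesis
      using egf_prod_nth[of n a "Suc i"] by (simp add: V_def)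
  qed
  define X where "X i j = fps_exp (real j) * egf deranged_bell * egf ordered_bell ^ i" for i j
  have c_real: "real_of_int (c i j) =
      (- 1) ^ (i + j) * falling_factorial (real j) i * real (Stirling m j)" for i j
    by (simp add: c_def falling_factorial_def)
  have "real (deranged_bell (n + m)) = fact n * fps_nth_deriv m (egf deranged_bell) $ n"
    by (simp add: fps_nth_deriv_egf egf_nth)
  also have "\<dots> = (\<Sum>j\<le>m. \<Sum>i\<le>j. real_of_int (c i j) * (fact n * X i j $ n))"
    unfolding fps_nth_deriv_egf_deranged_bell c_real[symmetric] X_def[symmetric]
    by (simp add: fps_sum_nth sum_distrib_left mult_ac)
  also have "\<dots> = real_of_int (\<Sum>j\<le>m. \<Sum>i\<le>j. c i j * 
      (\<Sum>ks | length ks = i + 2 \<and> sum_list ks = n. int (V i j ks)))"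
    unfolding X_def coeff by simp
  finally have "int (deranged_bell (n + m)) = (\<Sum>j\<le>m. \<Sum>i\<le>j. c i j * 
      (\<Sum>ks | length ks = i + 2 \<and> sum_list ks = n. int (V i j ks)))"
    by linarith
  also have "\<dots> = (\<Sum>i\<le>m. \<Sum>j=i..m. c i j * 
      (\<Sum>ks | length ks = i + 2 \<and> sum_list ks = n. int (V i j ks)))"
    unfolding sum.Sigma[OF finite_atMost ballI, OF finite_atMost]
      sum.Sigma[OF finite_atMost ballI, OF finite_atLeastAtMost]
    by (rule sum.reindex_bij_witness[of _ "\<lambda>(i, j). (j, i)" "\<lambda>(j, i). (i, j)"]) auto
  finally show ?thesis
    by (simp add: c_def V_def atLeast0AtMost sum_distrib_left mult_ac del: prod.op_ivl_Suc)
qed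

end
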